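(* Let $N \geq 1$, $K \geq 1$, let $C_1,\dots,C_K \geq 1$ be integers with $C_1 + \cdots + C_K = M$, and let $G$ be an $N\times N$ complex Gaussian matrix. Let $\tau \in \mathfrak{S}_M$ be a permutation with exactly $K$ cycles, of respective sizes $C_1,\dots,C_K$, and let $\sigma$ be uniformly distributed in $\mathfrak{S}_M$. Then $$\mathbb{E}_G\left( \prod_{k=1}^K \left| \mathrm{tr}\, G^{C_k} \right|^2 \right) = M!\ \mathbb{E}_\sigma\left( N^{\mathscr{C}([\sigma,\tau])} \right).$$
   Context: An $N\times N$ complex Gaussian matrix is a random matrix $G$ whose entries $G_{ij}$ are i.i.d. standard complex Gaussian random variables (independent centered real and imaginary parts, each of variance $1/2$, so $\mathbb{E}|G_{ij}|^2 = 1$ and $\mathbb{E}\,G_{ij}^2 = 0$); there is no rescaling by $N$. $\mathfrak{S}_M$ is the symmetric group on $\{1,\dots,M\}$. For a permutation $\pi$, $\mathscr{C}(\pi)$ denotes its number of cycles, fixed points being counted as cycles of length $1$ (so fixed points of $\tau$ correspond to $C_k = 1$). The commutator is $[\sigma,\tau] = \sigma\tau\sigma^{-1}\tau^{-1}$. *)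

theory Defs
  imports
    "HOL-Probability.Probability"
    "HOL-Combinatorics.Permutations"
    "HOL-Combinatorics.Orbits"
begin

context prob_space
begin

definition std_complex_gaussian :: "('a \<Rightarrow> complex) \<Rightarrow> bool" where
  "std_complex_gaussian Z \<longleftrightarrow>
     distributed M lborel (\<lambda>\<omega>. Re (Z \<omega>)) (\<lambda>x. ennreal (normal_density 0 (sqrt (1/2)) x)) \<and>
     distributed M lborel (\<lambda>\<omega>. Im (Z \<omega>)) (\<lambda>x. ennreal (normal_density 0 (sqrt (1/2)) x)) \<and>
     indep_var borel (\<lambda>\<omega>. Re (Z \<omega>)) borel (\<lambda>\<omega>. Im (Z \<omega>))"

definition complex_gaussian_matrix :: "('a \<Rightarrow> complex ^ 'n ^ 'n) \<Rightarrow> bool" where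
  "complex_gaussian_matrix G \<longleftrightarrow>
     (\<forall>i j. std_complex_gaussian (\<lambda>\<omega>. G \<omega> $ i $ j)) \<and>
     indep_vars (\<lambda>_. borel) (\<lambda>(i, j) \<omega>. G \<omega> $ i $ j) UNIV"

end

(* On the type of vectors of vectors, * and hence any power built from it would be
   componentwise; the matrix product is **. *)
definition matrix_pow :: "complex ^ 'n ^ 'n \<Rightarrow> nat \<Rightarrow> complex ^ 'n ^ 'n" where
  "matrix_pow A k = (((**) A) ^^ k) (mat 1)"

(* The set of cycles of a permutation p of S, each cycle being represented by its underlying set.
   A fixed point x contributes the cycle {x}. *)
definition perm_cycles :: "'a set \<Rightarrow> ('a \<Rightarrow> 'a) \<Rightarrow> 'a set set" where
  "perm_cycles S p = orbit p ` S"

definition num_cycles :: "'a set \<Rightarrow> ('a \<Rightarrow> 'a) \<Rightarrow> nat" where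
  "num_cycles S p = card (perm_cycles S p)"

(* p has exactly K cycles on S, of respective sizes C 1, ..., C K, for some enumeration of them. *)
definition has_cycle_sizes :: "'a set \<Rightarrow> ('a \<Rightarrow> 'a) \<Rightarrow> nat \<Rightarrow> (nat \<Rightarrow> nat) \<Rightarrow> bool" where
  "has_cycle_sizes S p K C \<longleftrightarrow>
     (\<exists>c. bij_betw c {1..K} (perm_cycles S p) \<and> (\<forall>k\<in>{1..K}. card (c k) = C k))"

definition perm_commutator :: "('a \<Rightarrow> 'a) \<Rightarrow> ('a \<Rightarrow> 'a) \<Rightarrow> 'a \<Rightarrow> 'a" where
  "perm_commutator p q = p \<circ> q \<circ> inv p \<circ> inv q"

end

theory Submission
  imports Defs
begin

text \<open>
  Write \<open>S\<close> for the set on which \<open>\<tau>\<close> acts and call a function \<open>i\<close> from \<open>S\<close> to the matrix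
  indices a labelling. The trace of \<open>A\<^sup>n\<close> is a sum over closed walks of length \<open>n\<close>, that is over
  labellings of an \<open>n\<close>-cycle. Multiplying over the cycles of \<open>\<tau>\<close> glues these labellings together:
  the product of the traces is the sum over all labellings \<open>i\<close> of \<open>S\<close> of the monomial
  \<open>\<Prod>m\<in>S. A\<^bsub>i m, i (\<tau> m)\<^esub>\<close> (\<open>prod_trace_matrix_pow_cycles\<close>). Its squared modulus is therefore a
  double sum over labellings \<open>i\<close> and \<open>j\<close>, where \<open>j\<close> comes from the conjugate factor.

  For Gaussian entries, the Wick formula (\<open>gaussian_wick_formula\<close>) evaluates the expectation of each
  term as the number of permutations \<open>\<sigma>\<close> of \<open>S\<close> that match the two lists of matrix positions, i.e.
  \<open>(i (\<sigma> m), i (\<tau> (\<sigma> m))) = (j m, j (\<tau> m))\<close> for all \<open>m\<close>. Exchange the sums and fix \<open>\<sigma>\<close>. The first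
  components force \<open>j = i \<circ> \<sigma>\<close>, and the second ones then say that \<open>i \<circ> \<tau> \<circ> \<sigma> = i \<circ> \<sigma> \<circ> \<tau>\<close>, which
  means that \<open>i\<close> is constant on the cycles of \<open>\<sigma> \<circ> \<tau> \<circ> \<sigma>\<^sup>-\<^sup>1 \<circ> \<tau>\<^sup>-\<^sup>1\<close>. Such an \<open>i\<close> is a free choice of
  one index per cycle of the commutator (\<open>card_matched_label_pairs\<close>). Summing over the \<open>M!\<close>
  permutations \<open>\<sigma>\<close> is \<open>M!\<close> times averaging over a uniform one.

  The Wick formula is proved by removing one conjugated factor at a time. Independence reduces this
  to a single entry \<open>Z\<close>, where it is Gaussian integration by parts,
  \<open>E (Z\<^sup>p cnj Z\<^sup>q\<^sup>+\<^sup>1) = p E (Z\<^sup>p\<^sup>-\<^sup>1 cnj Z\<^sup>q)\<close>: conjugate factors act as derivatives with respect to \<open>Z\<close>.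
\<close>

section \<open>Moments of a complex Gaussian variable\<close>

definition normal_moment_var_half :: "nat \<Rightarrow> real" where
  "normal_moment_var_half k = integral\<^sup>L lborel (\<lambda>x. normal_density 0 (sqrt (1/2)) x * x ^ k)"

text \<open>
  Integration by parts for the real Gaussian of variance \<open>1/2\<close>; read off here from the closed forms of
  the even and odd moments. For \<open>k = 0\<close> the truncated \<open>k - 1\<close> is harmless, its coefficient being \<open>0\<close>.
\<close>
lemma normal_moment_var_half_Suc:
  "normal_moment_var_half (Suc k) = real k / 2 * normal_moment_var_half (k - 1)"
proof -
  note \<mu>_def = normal_moment_var_half_def
  have pos: "0 < sqrt (1/2 :: real)" by simp
  have ev: "normal_moment_var_half (2 * j) = fact (2 * j) / (4 ^ j * fact j)" for j
    using integral_normal_moment_even[OF pos, of 0 j] by (simp add: \<mu>_def)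
  have od: "normal_moment_var_half (2 * j + 1) = 0" for j
    using integral_normal_moment_odd[OF pos, of 0 j] by (simp add: \<mu>_def)
  show ?thesis
  proof (cases "even k")
    case True
    then obtain j where j: "k = 2 * j" by (elim evenE)
    show ?thesis
    proof (cases j)
      case 0
      then show ?thesis using od[of 0] j by simp
    next
      case (Suc i)
      then have "k - 1 = 2 * i + 1" using j by simp
      then show ?thesis using od[of i] od[of j] j by simp
    qed
  next
    case False
    then obtain j where j: "k = 2 * j + 1" by (elim oddE)
    have "normal_moment_var_half (Suc k) = normal_moment_var_half (2 * Suc j)" by (simp add: j)
    also have "\<dots> = real k / 2 * (fact (2 * j) / (4 ^ j * fact j))"
      unfolding ev by (simp add: j add_eq_0_iff divide_simps)
    also have "\<dots> = real k / 2 * normal_moment_var_half (k - 1)" using ev[of j] j by simp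
    finally show ?thesis .
  qed
qed

lemma mixed_monomial_Suc_left:
  "of_real (Re z) ^ a * of_real (Im z) ^ b * z ^ Suc p * cnj z ^ q =
    of_real (Re z) ^ Suc a * of_real (Im z) ^ b * z ^ p * cnj z ^ q
    + \<i> * (of_real (Re z) ^ a * of_real (Im z) ^ Suc b * z ^ p * cnj z ^ q)"
  by (subst power_Suc, subst (3) complex_eq) (simp add: algebra_simps)

lemma mixed_monomial_Suc_right:
  "of_real (Re z) ^ a * of_real (Im z) ^ b * z ^ p * cnj z ^ Suc q =
    of_real (Re z) ^ Suc a * of_real (Im z) ^ b * z ^ p * cnj z ^ q
    - \<i> * (of_real (Re z) ^ a * of_real (Im z) ^ Suc b * z ^ p * cnj z ^ q)"
proof -
  have c: "cnj z ^ Suc q = (of_real (Re z) - \<i> * of_real (Im z)) * cnj z ^ q"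
    by (simp add: complex_eq_iff)
  show ?thesis unfolding c by (simp add: algebra_simps)
qed

context prob_space
begin

text \<open>
  The powers of the real and imaginary parts are carried along because multiplying a monomial by
  \<open>Z\<close> or its conjugate raises one of them: this closes the induction that proves integration by
  parts for monomials in \<open>Z\<close> and its conjugate.
\<close>
definition mixed_moment :: "('a \<Rightarrow> complex) \<Rightarrow> nat \<Rightarrow> nat \<Rightarrow> nat \<Rightarrow> nat \<Rightarrow> complex" where
  "mixed_moment Z a b p q =
     expectation (\<lambda>\<omega>. of_real (Re (Z \<omega>)) ^ a * of_real (Im (Z \<omega>)) ^ b * Z \<omega> ^ p * cnj (Z \<omega>) ^ q)"

lemma std_complex_gaussian_real_moments:
  assumes "std_complex_gaussian Z"
  shows "integrable M (\<lambda>\<omega>. complex_of_real (Re (Z \<omega>)) ^ a * of_real (Im (Z \<omega>)) ^ b)" (is ?int)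
    and "mixed_moment Z a b 0 0 =
      of_real (normal_moment_var_half a * normal_moment_var_half b)" (is ?val)
proof -
  define X where "X = (\<lambda>\<omega>. Re (Z \<omega>))"
  define Y where "Y = (\<lambda>\<omega>. Im (Z \<omega>))"
  have pos: "0 < sqrt (1/2 :: real)" by simp
  have DX: "distributed M lborel X (\<lambda>x. ennreal (normal_density 0 (sqrt (1/2)) x))"
    and DY: "distributed M lborel Y (\<lambda>x. ennreal (normal_density 0 (sqrt (1/2)) x))"
    and ind: "indep_var borel X borel Y"
    using assms unfolding std_complex_gaussian_def X_def Y_def by auto
  have int: "integrable M (\<lambda>\<omega>. V \<omega> ^ k)"
    and val: "expectation (\<lambda>\<omega>. V \<omega> ^ k) = normal_moment_var_half k"
    if "distributed M lborel V (\<lambda>x. ennreal (normal_density 0 (sqrt (1/2)) x))"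
    for V :: "'a \<Rightarrow> real" and k
    using distributed_integrable[OF that, of "\<lambda>x. x ^ k"] distributed_integral[OF that, of "\<lambda>x. x ^ k"]
      integrable_normal_moment[OF pos, of 0 k]
    by (simp_all add: normal_moment_var_half_def)
  have ind': "indep_var borel (\<lambda>\<omega>. X \<omega> ^ a) borel (\<lambda>\<omega>. Y \<omega> ^ b)"
    using indep_var_compose[OF ind, of "\<lambda>x. x ^ a" borel "\<lambda>x. x ^ b" borel] by (simp add: comp_def)
  have eq: "complex_of_real (Re (Z \<omega>)) ^ a * of_real (Im (Z \<omega>)) ^ b = of_real (X \<omega> ^ a * Y \<omega> ^ b)" for \<omega>
    by (simp add: X_def Y_def)
  show ?int
    unfolding eq by (intro integrable_of_real indep_var_integrable[OF ind' int[OF DX] int[OF DY]])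
  show ?val
    using indep_var_lebesgue_integral[OF ind' int[OF DX] int[OF DY]] val[OF DX, of a] val[OF DY, of b]
    unfolding mixed_moment_def power_0 mult_1_right eq integral_complex_of_real by simp
qed

lemma integrable_mixed_moment:
  assumes "std_complex_gaussian Z"
  shows "integrable M (\<lambda>\<omega>. of_real (Re (Z \<omega>)) ^ a * of_real (Im (Z \<omega>)) ^ b * Z \<omega> ^ p * cnj (Z \<omega>) ^ q)"
proof (induction q arbitrary: a b p)
  case 0
  show ?case
  proof (induction p arbitrary: a b)
    case 0
    show ?case using std_complex_gaussian_real_moments(1)[OF assms] by simp
  next
    case (Suc p)
    show ?case
      unfolding mixed_monomial_Suc_left
      by (intro Bochner_Integration.integrable_add integrable_mult_right Suc)
  qed
next
  case (Suc q)
  show ?case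
    unfolding mixed_monomial_Suc_right
    by (intro Bochner_Integration.integrable_diff integrable_mult_right Suc)
qed

lemma mixed_moment_Suc_left:
  assumes "std_complex_gaussian Z"
  shows "mixed_moment Z a b (Suc p) q = mixed_moment Z (Suc a) b p q + \<i> * mixed_moment Z a (Suc b) p q"
    unfolding mixed_moment_def mixed_monomial_Suc_left
    by (simp only: Bochner_Integration.integral_add integral_mult_right_zero
        integrable_mult_right integrable_mixed_moment[OF assms])

lemma mixed_moment_Suc_right:
  assumes "std_complex_gaussian Z"
  shows "mixed_moment Z a b p (Suc q) = mixed_moment Z (Suc a) b p q - \<i> * mixed_moment Z a (Suc b) p q"
    unfolding mixed_moment_def mixed_monomial_Suc_right
    by (simp only: Bochner_Integration.integral_diff integral_mult_right_zero
        integrable_mult_right integrable_mixed_moment[OF assms])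

text \<open>
  The right-hand side is the expectation of the Wirtinger derivative \<open>(\<partial>\<^sub>x - \<i> \<partial>\<^sub>y) / 2\<close> of the
  monomial \<open>x\<^sup>a y\<^sup>b z\<^sup>p (cnj z)\<^sup>q\<close>. This derivative takes the values \<open>1/2\<close>, \<open>-\<i>/2\<close>, \<open>1\<close> and \<open>0\<close> on \<open>x\<close>, \<open>y\<close>, \<open>z\<close>
  and \<open>cnj z\<close>, which is why \<open>q\<close> contributes no term. For \<open>p = q = 0\<close> it is the real recursion applied to
  both parts; a factor \<open>z\<close> or \<open>cnj z\<close> splits into its real and imaginary parts.
\<close>
lemma mixed_moment_by_parts:
  assumes Z: "std_complex_gaussian Z"
  shows "mixed_moment Z a b p (Suc q) =
    of_nat a / 2 * mixed_moment Z (a - 1) b p q - \<i> * of_nat b / 2 * mixed_moment Z a (b - 1) p q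
    + of_nat p * mixed_moment Z a b (p - 1) q"
proof (induction q arbitrary: a b p)
  case 0
  show ?case
  proof (induction p arbitrary: a b)
    case 0
    show ?case
      by (simp add: mixed_moment_Suc_right[OF Z] std_complex_gaussian_real_moments(2)[OF Z]
          normal_moment_var_half_Suc algebra_simps del: power_Suc)
  next
    case (Suc p)
    have "mixed_moment Z a b (Suc p) (Suc 0) =
      mixed_moment Z (Suc a) b p (Suc 0) + \<i> * mixed_moment Z a (Suc b) p (Suc 0)"
      by (rule mixed_moment_Suc_left[OF Z])
    also have "\<dots> = of_nat a / 2 * mixed_moment Z (a - 1) b (Suc p) 0
        - \<i> * of_nat b / 2 * mixed_moment Z a (b - 1) (Suc p) 0
        + of_nat (Suc p) * mixed_moment Z a b p 0"
      unfolding Suc[of "Suc a" b] Suc[of a "Suc b"] by (cases a; cases b; cases p)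
        (simp_all add: mixed_moment_Suc_left[OF Z] algebra_simps add_divide_distrib diff_divide_distrib)
    finally show ?case by simp
  qed
next
  case (Suc q)
  have "mixed_moment Z a b p (Suc (Suc q)) =
    mixed_moment Z (Suc a) b p (Suc q) - \<i> * mixed_moment Z a (Suc b) p (Suc q)"
    by (rule mixed_moment_Suc_right[OF Z])
  also have "\<dots> = of_nat a / 2 * mixed_moment Z (a - 1) b p (Suc q)
      - \<i> * of_nat b / 2 * mixed_moment Z a (b - 1) p (Suc q)
      + of_nat p * mixed_moment Z a b (p - 1) (Suc q)"
    unfolding Suc[of "Suc a" b p] Suc[of a "Suc b" p] by (cases a; cases b)
        (simp_all add: mixed_moment_Suc_right[OF Z] algebra_simps add_divide_distrib diff_divide_distrib)
  finally show ?case .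
qed

text \<open>
  Cancelling one conjugate factor against each of the \<open>p\<close> factors \<open>Z\<close>: the single-variable case of
  the recursion behind the Wick formula.
\<close>
lemma std_complex_gaussian_moment_Suc:
  assumes "std_complex_gaussian Z"
  shows "expectation (\<lambda>\<omega>. Z \<omega> ^ p * cnj (Z \<omega>) ^ Suc q) =
    of_nat p * expectation (\<lambda>\<omega>. Z \<omega> ^ (p - 1) * cnj (Z \<omega>) ^ q)"
  using mixed_moment_by_parts[OF assms, of 0 0 p q] by (simp add: mixed_moment_def)

end

section \<open>Matchings and the Wick formula\<close>

text \<open>
  The values outside \<open>T\<close> are fixed so that each matching is counted once.
\<close>
definition matchings :: "('m \<Rightarrow> 'c) \<Rightarrow> ('m \<Rightarrow> 'c) \<Rightarrow> 'm set \<Rightarrow> 'm set \<Rightarrow> ('m \<Rightarrow> 'm) set" where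
  "matchings a b S T = {\<sigma> \<in> T \<rightarrow>\<^sub>E S. bij_betw \<sigma> T S \<and> (\<forall>m\<in>T. a (\<sigma> m) = b m)}"

lemma finite_matchings: "finite S \<Longrightarrow> finite T \<Longrightarrow> finite (matchings a b S T)"
  unfolding matchings_def by (rule finite_subset[of _ "T \<rightarrow>\<^sub>E S"]) (auto intro: finite_PiE)

text \<open>
  A matching is the choice of a partner \<open>s\<close> of \<open>t\<close> together with a matching of what remains.
\<close>
lemma card_matchings_insert:
  assumes "finite S" "finite T" "t \<notin> T"
  shows "card (matchings a b S (insert t T)) =
    (\<Sum>s\<in>{s\<in>S. a s = b t}. card (matchings a b (S - {s}) T))"
proof -
  let ?D = "SIGMA s:{s\<in>S. a s = b t}. matchings a b (S - {s}) T"
  have "bij_betw (\<lambda>(s, \<sigma>). \<sigma>(t := s)) ?D (matchings a b S (insert t T))"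
  proof (rule bij_betw_byWitness[where f' = "\<lambda>\<sigma>. (\<sigma> t, \<sigma>(t := undefined))"])
    show "\<forall>x\<in>?D. (\<lambda>\<sigma>. (\<sigma> t, \<sigma>(t := undefined))) ((\<lambda>(s, \<sigma>). \<sigma>(t := s)) x) = x"
      using assms(3) by (auto simp: matchings_def fun_eq_iff PiE_iff extensional_def)
    show "\<forall>\<sigma>\<in>matchings a b S (insert t T). (\<lambda>(s, \<sigma>). \<sigma>(t := s)) (\<sigma> t, \<sigma>(t := undefined)) = \<sigma>"
      by auto
    show "(\<lambda>(s, \<sigma>). \<sigma>(t := s)) ` ?D \<subseteq> matchings a b S (insert t T)"
    proof safe
      fix s \<sigma> assume s: "s \<in> S" "a s = b t" and \<sigma>: "\<sigma> \<in> matchings a b (S - {s}) T"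
      have "bij_betw (\<sigma>(t := s)) T (S - {s})"
        using \<sigma> assms(3) by (subst bij_betw_cong[of T _ \<sigma>]) (auto simp: matchings_def)
      then have "bij_betw (\<sigma>(t := s)) (insert t T) (insert s (S - {s}))"
        using notIn_Un_bij_betw[of t T "\<sigma>(t := s)" "S - {s}"] assms(3) by simp
      moreover have "insert s (S - {s}) = S" using s by auto
      ultimately show "\<sigma>(t := s) \<in> matchings a b S (insert t T)"
        using \<sigma> s assms(3) by (auto simp: matchings_def PiE_iff extensional_def)
    qed
    show "(\<lambda>\<sigma>. (\<sigma> t, \<sigma>(t := undefined))) ` matchings a b S (insert t T) \<subseteq> ?D"
    proof safe
      fix \<sigma> assume \<sigma>: "\<sigma> \<in> matchings a b S (insert t T)"
      then have bij: "bij_betw \<sigma> (insert t T) S" by (simp add: matchings_def)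
      show "\<sigma> t \<in> S" "a (\<sigma> t) = b t" using \<sigma> by (auto simp: matchings_def)
      have "bij_betw \<sigma> T (S - {\<sigma> t})"
        using bij_betw_DiffI[OF bij, of "{t}" "{\<sigma> t}"] assms(3) bij
        by (auto simp: bij_betw_def)
      then have ne: "\<sigma> m \<in> S" "\<sigma> m \<noteq> \<sigma> t" if "m \<in> T" for m
        using that by (auto dest: bij_betwE)
      have "bij_betw (\<sigma>(t := undefined)) T (S - {\<sigma> t})"
        using \<open>bij_betw \<sigma> T (S - {\<sigma> t})\<close>
assms(3) by (subst bij_betw_cong[of T _ \<sigma>]) auto
      then show "\<sigma>(t := undefined) \<in> matchings a b (S - {\<sigma> t}) T"
        using \<sigma> assms(3) ne by (auto simp: matchings_def PiE_iff extensional_def)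
    qed
  qed
  then have "card (matchings a b S (insert t T)) = card ?D"
    by (simp add: bij_betw_same_card)
  also have "\<dots> = (\<Sum>s\<in>{s\<in>S. a s = b t}. card (matchings a b (S - {s}) T))"
    using assms by (intro card_SigmaI) (auto intro: finite_matchings)
  finally show ?thesis .
qed

text \<open>
  For \<open>T = S\<close> a matching is a permutation of \<open>S\<close>, up to the convention for its values outside \<open>S\<close>.
\<close>
lemma card_matchings_permutes:
  assumes "finite S"
  shows "card (matchings a b S S) = card {\<sigma>. \<sigma> permutes S \<and> (\<forall>m\<in>S. a (\<sigma> m) = b m)}"
proof -
  have "bij_betw (\<lambda>\<sigma>. restrict \<sigma> S) {\<sigma>. \<sigma> permutes S \<and> (\<forall>m\<in>S. a (\<sigma> m) = b m)} (matchings a b S S)"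
  proof (rule bij_betw_byWitness[where f' = "\<lambda>\<sigma> m. if m \<in> S then \<sigma> m else m"])
    show "(\<lambda>\<sigma> m. if m \<in> S then \<sigma> m else m) ` matchings a b S S
        \<subseteq> {\<sigma>. \<sigma> permutes S \<and> (\<forall>m\<in>S. a (\<sigma> m) = b m)}"
    proof safe
      fix \<sigma> assume \<sigma>: "\<sigma> \<in> matchings a b S S"
      then have "bij_betw (\<lambda>m. if m \<in> S then \<sigma> m else m) S S"
        by (subst bij_betw_cong[of S _ \<sigma>]) (auto simp: matchings_def)
      then show "(\<lambda>m. if m \<in> S then \<sigma> m else m) permutes S"
        by (intro bij_imp_permutes) auto
    qed (auto simp: matchings_def)
    show "(\<lambda>\<sigma>. restrict \<sigma> S) ` {\<sigma>. \<sigma> permutes S \<and> (\<forall>m\<in>S. a (\<sigma> m) = b m)} \<subseteq> matchings a b S S"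
    proof safe
      fix \<sigma> assume \<sigma>: "\<sigma> permutes S" "\<forall>m\<in>S. a (\<sigma> m) = b m"
      have "bij_betw (restrict \<sigma> S) S S"
        using permutes_imp_bij[OF \<sigma>(1)] by (subst bij_betw_cong[of S _ \<sigma>]) auto
      then show "restrict \<sigma> S \<in> matchings a b S S"
        using \<sigma> by (auto simp: matchings_def permutes_in_image)
    qed
  qed (auto simp: fun_eq_iff matchings_def PiE_iff extensional_def permutes_not_in)
  then show ?thesis by (simp add: bij_betw_same_card)
qed

context prob_space
begin

lemma gaussian_family_integrable_moment:
  fixes Z :: "'i::finite \<Rightarrow> 'a \<Rightarrow> complex"
  assumes Z: "\<And>e. std_complex_gaussian (Z e)" and ind: "indep_vars (\<lambda>_. borel) Z UNIV"
  shows "integrable M (\<lambda>\<omega>. \<Prod>e\<in>UNIV. Z e \<omega> ^ p e * cnj (Z e \<omega>) ^ q e)" (is ?int)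
    and "expectation (\<lambda>\<omega>. \<Prod>e\<in>UNIV. Z e \<omega> ^ p e * cnj (Z e \<omega>) ^ q e) =
      (\<Prod>e\<in>UNIV. expectation (\<lambda>\<omega>. Z e \<omega> ^ p e * cnj (Z e \<omega>) ^ q e))" (is ?eq)
proof -
  have int: "integrable M (\<lambda>\<omega>. Z e \<omega> ^ p e * cnj (Z e \<omega>) ^ q e)" for e
    using integrable_mixed_moment[OF Z[of e], of 0 0 "p e" "q e"] by simp
  have "(\<lambda>z. z ^ p e * cnj z ^ q e) \<in> borel_measurable borel" for e
    by (rule borel_measurable_continuous_onI) (intro continuous_intros)
  then have "indep_vars (\<lambda>_. borel) (\<lambda>e \<omega>. Z e \<omega> ^ p e * cnj (Z e \<omega>) ^ q e) UNIV"
    by (rule indep_vars_compose2[OF ind, of "\<lambda>e z. z ^ p e * cnj z ^ q e"])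
  then show ?int ?eq
    using indep_vars_integrable[of UNIV "\<lambda>e \<omega>. Z e \<omega> ^ p e * cnj (Z e \<omega>) ^ q e"]
      indep_vars_lebesgue_integral[of UNIV "\<lambda>e \<omega>. Z e \<omega> ^ p e * cnj (Z e \<omega>) ^ q e"] int
    by auto
qed

text \<open>
  Collecting equal factors turns a product over positions into a product over distinct, and hence
  independent, variables.
\<close>
lemma prod_group_by_label:
  fixes z :: "'i::finite \<Rightarrow> complex"
  assumes "finite S"
  shows "(\<Prod>m\<in>S. z (a m)) = (\<Prod>e\<in>UNIV. z e ^ card {m\<in>S. a m = e})"
proof -
  have "(\<Prod>m\<in>S. z (a m)) = (\<Prod>e\<in>UNIV. \<Prod>m\<in>{m\<in>S. a m = e}. z (a m))"
    using assms by (intro prod.group[symmetric]) auto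
  also have "\<dots> = (\<Prod>e\<in>UNIV. z e ^ card {m\<in>S. a m = e})"
    by (intro prod.cong refl) simp
  finally show ?thesis .
qed

lemma
  fixes Z :: "'i::finite \<Rightarrow> 'a \<Rightarrow> complex"
  assumes Z: "\<And>e. std_complex_gaussian (Z e)" and ind: "indep_vars (\<lambda>_. borel) Z UNIV"
    and S: "finite S" and T: "finite T"
  shows gaussian_monomial_integrable:
      "integrable M (\<lambda>\<omega>. (\<Prod>m\<in>S. Z (a m) \<omega>) * (\<Prod>m\<in>T. cnj (Z (b m) \<omega>)))" (is ?int)
    and gaussian_monomial_expectation:
      "expectation (\<lambda>\<omega>. (\<Prod>m\<in>S. Z (a m) \<omega>) * (\<Prod>m\<in>T. cnj (Z (b m) \<omega>))) =
       (\<Prod>e\<in>UNIV. expectation (\<lambda>\<omega>. Z e \<omega> ^ card {m\<in>S. a m = e} *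
                                   cnj (Z e \<omega>) ^ card {m\<in>T. b m = e}))" (is ?eq)
proof -
  have eq: "(\<Prod>m\<in>S. Z (a m) \<omega>) * (\<Prod>m\<in>T. cnj (Z (b m) \<omega>)) =
    (\<Prod>e\<in>UNIV. Z e \<omega> ^ card {m\<in>S. a m = e} * cnj (Z e \<omega>) ^ card {m\<in>T. b m = e})" for \<omega>
    using prod_group_by_label[OF S, of "\<lambda>e. Z e \<omega>" a]
      prod_group_by_label[OF T, of "\<lambda>e. cnj (Z e \<omega>)" b]
    by (simp add: prod.distrib)
  show ?int ?eq
    unfolding eq using gaussian_family_integrable_moment[OF Z ind] by auto
qed

text \<open>
  Both sides satisfy the same recursion in \<open>T\<close>. On the left, let \<open>e = b t\<close>. The moment recursion for
  \<open>Z e\<close> gives the number of \<open>s\<close> in \<open>S\<close> with \<open>a s = e\<close>, times the expectation with one \<open>Z e\<close> and one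
  conjugate less; this is one summand for each possible partner \<open>s\<close> of \<open>t\<close>. Since \<open>S\<close> and
  \<open>T\<close> shrink together, the recursion ends with both of them empty.
\<close>
theorem gaussian_wick_formula:
  fixes Z :: "'i::finite \<Rightarrow> 'a \<Rightarrow> complex"
  assumes Z: "\<And>e. std_complex_gaussian (Z e)" and ind: "indep_vars (\<lambda>_. borel) Z UNIV"
    and "finite S" "finite T" "card S = card T"
  shows "expectation (\<lambda>\<omega>. (\<Prod>m\<in>S. Z (a m) \<omega>) * (\<Prod>m\<in>T. cnj (Z (b m) \<omega>))) =
    of_nat (card (matchings a b S T))"
  using assms(4,3,5)
proof (induction T arbitrary: S rule: finite_induct)
  case empty
  then have "matchings a b S {} = {\<lambda>x. undefined}" by (auto simp: matchings_def bij_betw_def)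
  then show ?case using empty by (simp add: prob_space)
next
  case (insert t T)
  define m where "m e p q = expectation (\<lambda>\<omega>. Z e \<omega> ^ p * cnj (Z e \<omega>) ^ q)" for e p q
  define p where "p e = card {x\<in>S. a x = e}" for e
  define q where "q e = card {x\<in>T. b x = e}" for e
  define A where "A = {s\<in>S. a s = b t}"
  have q': "card {x\<in>insert t T. b x = e} = (if e = b t then Suc (q e) else q e)" for e
  proof -
    have "{x\<in>insert t T. b x = e} = (if e = b t then insert t {x\<in>T. b x = e} else {x\<in>T. b x = e})"
      by auto
    then show ?thesis using insert by (auto simp: q_def)
  qed
  have p': "card {x\<in>S - {s}. a x = e} = (if e = b t then p e - 1 else p e)" if "s \<in> A" for s e
  proof -
    have "{x\<in>S - {s}. a x = e} = (if e = b t then {x\<in>S. a x = e} - {s} else {x\<in>S. a x = e})"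
      using that by (auto simp: A_def)
    then show ?thesis using insert that by (auto simp: p_def A_def)
  qed
  \<comment> \<open>The variables other than \<open>Z (b t)\<close> keep their exponents throughout the step.\<close>
  let ?rest = "\<Prod>e\<in>UNIV - {b t}. m e (p e) (q e)"
  have IH: "of_nat (card (matchings a b (S - {s}) T)) = m (b t) (p (b t) - 1) (q (b t)) * ?rest"
    if s: "s \<in> A" for s
  proof -
    have "of_nat (card (matchings a b (S - {s}) T)) =
        expectation (\<lambda>\<omega>. (\<Prod>m\<in>S - {s}. Z (a m) \<omega>) * (\<Prod>m\<in>T. cnj (Z (b m) \<omega>)))"
      using s insert by (intro insert.IH[symmetric]) (auto simp: A_def)
    also have "\<dots> = (\<Prod>e\<in>UNIV. m e (if e = b t then p e - 1 else p e) (q e))"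
      using gaussian_monomial_expectation[OF Z ind finite_Diff[OF insert.prems(1)] insert.hyps(1)]
      by (simp only: p'[OF s] m_def q_def)
    also have "\<dots> = m (b t) (p (b t) - 1) (q (b t)) * ?rest"
      by (subst prod.remove[of UNIV "b t"]) auto
    finally show ?thesis .
  qed
  have "expectation (\<lambda>\<omega>. (\<Prod>m\<in>S. Z (a m) \<omega>) * (\<Prod>m\<in>insert t T. cnj (Z (b m) \<omega>))) =
      (\<Prod>e\<in>UNIV. m e (p e) (if e = b t then Suc (q e) else q e))"
    using gaussian_monomial_expectation[OF Z ind insert.prems(1) finite.insertI[OF insert.hyps(1)]]
    by (simp only: q' m_def p_def)
  also have "\<dots> = m (b t) (p (b t)) (Suc (q (b t))) * ?rest"
    by (subst prod.remove[of UNIV "b t"]) auto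
  also have "\<dots> = (\<Sum>s\<in>A. m (b t) (p (b t) - 1) (q (b t)) * ?rest)"
    unfolding m_def std_complex_gaussian_moment_Suc[OF Z] by (simp add: A_def p_def)
  also have "\<dots> = of_nat (card (matchings a b S (insert t T)))"
    using insert by (subst card_matchings_insert) (auto simp: IH A_def)
  finally show ?case .
qed

end

section \<open>Cycles and labellings constant on them\<close>

lemma orbit_permutes_eq_iff:
  assumes "\<pi> permutes S" "finite S" "y \<in> orbit \<pi> x"
  shows "orbit \<pi> y = orbit \<pi> x"
  using assms by (intro orbit_cyclic_eq3 cyclic_on_orbit)

lemma self_in_orbit_permutes: "\<pi> permutes S \<Longrightarrow> finite S \<Longrightarrow> x \<in> orbit \<pi> x"
  by (rule permutation_self_in_orbit) (auto simp: permutation_permutes)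

lemma Union_perm_cycles:
  assumes "\<pi> permutes S" "finite S"
  shows "\<Union>(perm_cycles S \<pi>) = S"
  using assms permutes_orbit_subset[OF assms(1)] self_in_orbit_permutes[OF assms]
  by (auto simp: perm_cycles_def)

lemma disjoint_perm_cycles:
  assumes "\<pi> permutes S" "finite S"
  shows "disjoint (perm_cycles S \<pi>)"
  using orbit_permutes_eq_iff[OF assms] unfolding disjoint_def perm_cycles_def by blast

text \<open>
  A labelling invariant under \<open>\<pi>\<close> factors through the map that sends a point to its cycle.
\<close>
lemma card_invariant_labellings:
  assumes \<pi>: "\<pi> permutes S" and S: "finite S"
  shows "card {i \<in> S \<rightarrow>\<^sub>E (UNIV :: 'n::finite set). \<forall>x\<in>S. i (\<pi> x) = i x} = CARD('n) ^ num_cycles S \<pi>"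
proof -
  let ?I = "{i \<in> S \<rightarrow>\<^sub>E (UNIV :: 'n set). \<forall>x\<in>S. i (\<pi> x) = i x}"
  have const: "i y = i x" if "i \<in> ?I" "x \<in> S" "y \<in> orbit \<pi> x" for i x y
    using that(3)
  proof induction
    case base
    then show ?case using that by simp
  next
    case (step y)
    moreover have "y \<in> S" using permutes_orbit_subset[OF \<pi> that(2)] step by auto
    ultimately show ?case using that by simp
  qed
  have "bij_betw (\<lambda>g. \<lambda>x\<in>S. g (orbit \<pi> x)) (perm_cycles S \<pi> \<rightarrow>\<^sub>E (UNIV :: 'n set)) ?I"
  proof (rule bij_betw_byWitness[where f' = "\<lambda>i. \<lambda>c\<in>perm_cycles S \<pi>. i (SOME x. x \<in> c)"])
    have some: "(SOME y. y \<in> orbit \<pi> x) \<in> orbit \<pi> x" for x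
      using orbit.base[of \<pi> x] by (rule someI)
    show "\<forall>g\<in>perm_cycles S \<pi> \<rightarrow>\<^sub>E (UNIV :: 'n set).
      (\<lambda>c\<in>perm_cycles S \<pi>. (\<lambda>x\<in>S. g (orbit \<pi> x)) (SOME x. x \<in> c)) = g"
    proof
      fix g assume g: "g \<in> perm_cycles S \<pi> \<rightarrow>\<^sub>E (UNIV :: 'n set)"
      show "(\<lambda>c\<in>perm_cycles S \<pi>. (\<lambda>x\<in>S. g (orbit \<pi> x)) (SOME x. x \<in> c)) = g"
      proof
        fix c
        show "(\<lambda>c\<in>perm_cycles S \<pi>. (\<lambda>x\<in>S. g (orbit \<pi> x)) (SOME x. x \<in> c)) c = g c"
        proof (cases "c \<in> perm_cycles S \<pi>")
          case True
          then obtain x where x: "x \<in> S" "c = orbit \<pi> x" by (auto simp: perm_cycles_def)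
          then have "(SOME y. y \<in> c) \<in> S" "orbit \<pi> (SOME y. y \<in> c) = c"
            using some[of x] permutes_orbit_subset[OF \<pi>] orbit_permutes_eq_iff[OF \<pi> S] by auto
          then show ?thesis using True by simp
        next
          case False
          then show ?thesis using g by (auto simp: PiE_iff extensional_def)
        qed
      qed
    qed
    show "\<forall>i\<in>?I. (\<lambda>x\<in>S. (\<lambda>c\<in>perm_cycles S \<pi>. i (SOME x. x \<in> c)) (orbit \<pi> x)) = i"
    proof
      fix i assume i: "i \<in> ?I"
      show "(\<lambda>x\<in>S. (\<lambda>c\<in>perm_cycles S \<pi>. i (SOME x. x \<in> c)) (orbit \<pi> x)) = i"
        using i const[OF i _ some] by (auto simp: fun_eq_iff perm_cycles_def PiE_iff extensional_def)
    qed
    show "(\<lambda>g. \<lambda>x\<in>S. g (orbit \<pi> x)) ` (perm_cycles S \<pi> \<rightarrow>\<^sub>E (UNIV :: 'n set)) \<subseteq> ?I"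
      using permutation_orbit_step[of \<pi>] \<pi> S
      by (auto simp: permutation_permutes permutes_in_image)
        metis
  qed auto
  then have "card ?I = card (perm_cycles S \<pi> \<rightarrow>\<^sub>E (UNIV :: 'n set))"
    by (simp add: bij_betw_same_card)
  also have "\<dots> = CARD('n) ^ num_cycles S \<pi>"
    using S by (simp add: card_PiE num_cycles_def perm_cycles_def)
  finally show ?thesis .
qed

section \<open>Traces of matrix powers as sums over labellings\<close>

lemma matrix_pow_0: "matrix_pow A 0 = mat 1"
  by (simp add: matrix_pow_def)

lemma matrix_pow_Suc: "matrix_pow A (Suc k) = A ** matrix_pow A k"
  by (simp add: matrix_pow_def)

lemma matrix_pow_Suc_right: "matrix_pow A (Suc k) = matrix_pow A k ** A"
proof (induction k)
  case 0
  show ?case by (simp add: matrix_pow_Suc matrix_pow_0)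
next
  case (Suc k)
  have "matrix_pow A (Suc (Suc k)) = A ** (matrix_pow A k ** A)"
    using Suc by (simp add: matrix_pow_Suc[of A "Suc k"])
  then show ?case by (simp add: matrix_mul_assoc matrix_pow_Suc)
qed

lemma sum_PiE_insert:
  fixes F :: "('a \<Rightarrow> 'b) \<Rightarrow> 'c::comm_monoid_add"
  assumes "x \<notin> S"
  shows "(\<Sum>f\<in>insert x S \<rightarrow>\<^sub>E B. F f) = (\<Sum>f\<in>S \<rightarrow>\<^sub>E B. \<Sum>y\<in>B. F (f(x := y)))"
proof -
  have "(\<Sum>f\<in>insert x S \<rightarrow>\<^sub>E B. F f) = (\<Sum>(y, f)\<in>B \<times> (S \<rightarrow>\<^sub>E B). F (f(x := y)))"
    unfolding PiE_insert_eq
    by (subst sum.reindex[OF inj_combinator[OF assms]]) (simp add: comp_def case_prod_unfold)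
  also have "\<dots> = (\<Sum>f\<in>S \<rightarrow>\<^sub>E B. \<Sum>y\<in>B. F (f(x := y)))"
    by (subst sum.cartesian_product[symmetric], subst sum.swap) simp
  finally show ?thesis .
qed

text \<open>
  Both ends of the walk stay free, weighted by an arbitrary \<open>h\<close>: appending a step then amounts to
  changing \<open>h\<close>, and the induction needs no case distinction on the end points.
\<close>
lemma sum_matrix_pow_walks:
  fixes A :: "complex ^ 'n ^ 'n" and h :: "'n \<Rightarrow> 'n \<Rightarrow> complex"
  shows "(\<Sum>x\<in>UNIV. \<Sum>y\<in>UNIV. matrix_pow A k $ x $ y * h x y) =
    (\<Sum>f\<in>{..<Suc k} \<rightarrow>\<^sub>E UNIV. (\<Prod>j<k. A $ f j $ f (Suc j)) * h (f 0) (f k))"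
proof (induction k arbitrary: h)
  case 0
  have "(\<Sum>f\<in>{..<Suc 0} \<rightarrow>\<^sub>E (UNIV :: 'n set). h (f 0) (f 0)) = (\<Sum>x\<in>UNIV. h x x)"
    using sum_PiE_insert[of "0::nat" "{}" "\<lambda>f. h (f 0) (f 0)" UNIV] by (simp add: lessThan_Suc)
  then show ?case
    by (simp add: matrix_pow_0 mat_def if_distrib[of "\<lambda>u. u * _"] cong: if_cong)
next
  case (Suc k)
  have "(\<Sum>x\<in>UNIV. \<Sum>z\<in>UNIV. matrix_pow A (Suc k) $ x $ z * h x z) =
      (\<Sum>x\<in>UNIV. \<Sum>y\<in>UNIV. matrix_pow A k $ x $ y * (\<Sum>z\<in>UNIV. A $ y $ z * h x z))"
    unfolding matrix_pow_Suc_right matrix_matrix_mult_def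
    by (simp add: sum_distrib_left sum_distrib_right mult.assoc) (rule sum.cong[OF refl], rule sum.swap)
  also have "\<dots> = (\<Sum>f\<in>{..<Suc k} \<rightarrow>\<^sub>E UNIV.
      (\<Prod>j<k. A $ f j $ f (Suc j)) * (\<Sum>z\<in>UNIV. A $ f k $ z * h (f 0) z))"
    by (rule Suc)
  also have "\<dots> = (\<Sum>f\<in>{..<Suc k} \<rightarrow>\<^sub>E UNIV. \<Sum>z\<in>UNIV.
      (\<Prod>j<Suc k. A $ (f(Suc k := z)) j $ (f(Suc k := z)) (Suc j)) *
      h ((f(Suc k := z)) 0) ((f(Suc k := z)) (Suc k)))"
    by (intro sum.cong refl) (simp add: sum_distrib_left mult.assoc)
  also have "\<dots> = (\<Sum>f\<in>{..<Suc (Suc k)} \<rightarrow>\<^sub>E UNIV.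
      (\<Prod>j<Suc k. A $ f j $ f (Suc j)) * h (f 0) (f (Suc k)))"
    unfolding lessThan_Suc[of "Suc k"] by (subst sum_PiE_insert) auto
  finally show ?case .
qed

text \<open>
  The weight \<open>h x y = A\<^bsub>y, x\<^esub>\<close> closes a walk of length \<open>n - 1\<close>.
\<close>
lemma trace_matrix_pow_closed_walks:
  fixes A :: "complex ^ 'n ^ 'n"
  assumes "n > 0"
  shows "trace (matrix_pow A n) =
    (\<Sum>f\<in>{..<n} \<rightarrow>\<^sub>E UNIV. \<Prod>j<n. A $ f j $ f (Suc j mod n))"
proof -
  obtain k where n: "n = Suc k" using assms by (cases n) auto
  have "trace (matrix_pow A n) = (\<Sum>x\<in>UNIV. \<Sum>y\<in>UNIV. matrix_pow A k $ x $ y * A $ y $ x)"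
    by (simp add: n trace_def matrix_pow_Suc_right matrix_matrix_mult_def)
  also have "\<dots> = (\<Sum>f\<in>{..<n} \<rightarrow>\<^sub>E UNIV. (\<Prod>j<k. A $ f j $ f (Suc j)) * A $ f k $ f 0)"
    unfolding n by (rule sum_matrix_pow_walks)
  also have "\<dots> = (\<Sum>f\<in>{..<n} \<rightarrow>\<^sub>E UNIV. \<Prod>j<n. A $ f j $ f (Suc j mod n))"
    unfolding n by (intro sum.cong refl) simp
  finally show ?thesis .
qed

lemma sum_PiE_reindex_bij:
  assumes "bij_betw \<beta> I J"
  shows "(\<Sum>f\<in>J \<rightarrow>\<^sub>E B. F (\<lambda>i\<in>I. f (\<beta> i))) = (\<Sum>g\<in>I \<rightarrow>\<^sub>E B. F g)"
proof (rule sum.reindex_bij_witness[where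
      j = "\<lambda>f. \<lambda>i\<in>I. f (\<beta> i)" and i = "\<lambda>g. \<lambda>j\<in>J. g (inv_into I \<beta> j)"])
  fix f assume f: "f \<in> J \<rightarrow>\<^sub>E B"
  show "(\<lambda>j\<in>J. (\<lambda>i\<in>I. f (\<beta> i)) (inv_into I \<beta> j)) = f"
    using f assms by (auto simp: fun_eq_iff PiE_iff extensional_def bij_betw_def
        f_inv_into_f inv_into_into)
  show "(\<lambda>i\<in>I. f (\<beta> i)) \<in> I \<rightarrow>\<^sub>E B" using f assms by (auto dest: bij_betwE)
next
  fix g assume g: "g \<in> I \<rightarrow>\<^sub>E B"
  show "(\<lambda>i\<in>I. (\<lambda>j\<in>J. g (inv_into I \<beta> j)) (\<beta> i)) = g"
    using g assms by (auto simp: fun_eq_iff PiE_iff extensional_def bij_betw_def)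
  show "(\<lambda>j\<in>J. g (inv_into I \<beta> j)) \<in> J \<rightarrow>\<^sub>E B"
    using g assms by (auto simp: bij_betw_def intro: inv_into_into)
qed simp

text \<open>
  The points \<open>x, \<pi> x, \<pi> (\<pi> x), \<dots>\<close> enumerate the cycle in such a way that \<open>\<pi>\<close> becomes the cyclic shift,
  so closed walks become labellings of the cycle.
\<close>
lemma trace_matrix_pow_cycle:
  fixes A :: "complex ^ 'n ^ 'n"
  assumes self: "x \<in> orbit \<pi> x"
  shows "trace (matrix_pow A (card (orbit \<pi> x))) =
    (\<Sum>i\<in>orbit \<pi> x \<rightarrow>\<^sub>E UNIV. \<Prod>m\<in>orbit \<pi> x. A $ i m $ i (\<pi> m))"
proof -
  define n where "n = funpow_dist1 \<pi> x x"
  define \<beta> where "\<beta> j = (\<pi> ^^ j) x" for j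
  have "n > 0" by (simp add: n_def)
  have bij: "bij_betw \<beta> {..<n} (orbit \<pi> x)"
    unfolding bij_betw_def \<beta>_def n_def
    using inj_on_funpow_dist1[OF self] orbit_conv_funpow_dist1[OF self]
    by (auto simp: atLeast0LessThan)
  have per: "(\<pi> ^^ n) x = x" unfolding n_def by (rule funpow_dist1_prop[OF self])
  have step: "\<pi> (\<beta> j) = \<beta> (Suc j mod n)" for j
    unfolding \<beta>_def using funpow_mod_eq[OF per, of "Suc j"] by simp
  have "card (orbit \<pi> x) = n" using bij_betw_same_card[OF bij] by simp
  then have "trace (matrix_pow A (card (orbit \<pi> x))) =
      (\<Sum>f\<in>{..<n} \<rightarrow>\<^sub>E UNIV. \<Prod>j<n. A $ f j $ f (Suc j mod n))"
    using trace_matrix_pow_closed_walks[OF \<open>n > 0\<close>, of A] by simp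
  also have "\<dots> = (\<Sum>i\<in>orbit \<pi> x \<rightarrow>\<^sub>E UNIV. \<Prod>j<n. A $ i (\<beta> j) $ i (\<beta> (Suc j mod n)))"
    using \<open>n > 0\<close> unfolding sum_PiE_reindex_bij[OF bij, of "\<lambda>f. \<Prod>j<n. A $ f j $ f (Suc j mod n)", symmetric]
    by (intro sum.cong[OF refl] prod.cong[OF refl]) simp
  also have "\<dots> = (\<Sum>i\<in>orbit \<pi> x \<rightarrow>\<^sub>E UNIV. \<Prod>m\<in>orbit \<pi> x. A $ i m $ i (\<pi> m))"
    unfolding step[symmetric]
    by (intro sum.cong refl) (rule prod.reindex_bij_betw[OF bij, of "\<lambda>m. A $ _ m $ _ (\<pi> m)"])
  finally show ?thesis .
qed

text \<open>
  The two congruence hypotheses say that \<open>F\<close> and \<open>G\<close> only look at the values on \<open>S\<close> and on \<open>T\<close>.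
\<close>
lemma sum_PiE_Un_disjoint:
  fixes F G :: "('a \<Rightarrow> 'b) \<Rightarrow> 'c::comm_semiring_0"
  assumes "S \<inter> T = {}"
    and F: "\<And>f g. (\<And>x. x \<in> S \<Longrightarrow> f x = g x) \<Longrightarrow> F f = F g"
    and G: "\<And>f g. (\<And>x. x \<in> T \<Longrightarrow> f x = g x) \<Longrightarrow> G f = G g"
  shows "(\<Sum>f\<in>S \<rightarrow>\<^sub>E B. F f) * (\<Sum>f\<in>T \<rightarrow>\<^sub>E B. G f) = (\<Sum>f\<in>S \<union> T \<rightarrow>\<^sub>E B. F f * G f)"
proof -
  have "(\<Sum>f\<in>S \<rightarrow>\<^sub>E B. F f) * (\<Sum>f\<in>T \<rightarrow>\<^sub>E B. G f) =
      (\<Sum>(f, g)\<in>(S \<rightarrow>\<^sub>E B) \<times> (T \<rightarrow>\<^sub>E B). F f * G g)"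
    by (simp add: sum_product sum.cartesian_product)
  also have "\<dots> = (\<Sum>f\<in>S \<union> T \<rightarrow>\<^sub>E B. F f * G f)"
  proof (rule sum.reindex_bij_witness[where i = "\<lambda>h. (restrict h S, restrict h T)"
        and j = "\<lambda>(f, g) x. if x \<in> S then f x else g x"])
    fix p assume p: "p \<in> (S \<rightarrow>\<^sub>E B) \<times> (T \<rightarrow>\<^sub>E B)"
    obtain f g where fg: "p = (f, g)" by (cases p)
    have "F (\<lambda>x. if x \<in> S then f x else g x) = F f" by (rule F) simp
    moreover have "G (\<lambda>x. if x \<in> S then f x else g x) = G g" using assms(1) by (intro G) auto
    ultimately show "F ((\<lambda>(f, g) x. if x \<in> S then f x else g x) p) *
        G ((\<lambda>(f, g) x. if x \<in> S then f x else g x) p) = (\<lambda>(f, g). F f * G g) p"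
      by (simp add: fg)
  qed (use assms(1) in \<open>auto simp: fun_eq_iff PiE_iff extensional_def\<close>)
  finally show ?thesis .
qed

lemma prod_sum_PiE_disjoint_family:
  fixes F :: "'a set \<Rightarrow> ('a \<Rightarrow> 'b) \<Rightarrow> 'c::comm_semiring_1"
  assumes "finite \<D>" "disjoint \<D>"
    and "\<And>c f g. c \<in> \<D> \<Longrightarrow> (\<And>x. x \<in> c \<Longrightarrow> f x = g x) \<Longrightarrow> F c f = F c g"
  shows "(\<Prod>c\<in>\<D>. \<Sum>f\<in>c \<rightarrow>\<^sub>E B. F c f) = (\<Sum>f\<in>\<Union>\<D> \<rightarrow>\<^sub>E B. \<Prod>c\<in>\<D>. F c f)"
  using assms
proof (induction \<D> rule: finite_induct)
  case empty
  then show ?case by simp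
next
  case (insert c \<D>)
  have disj: "c \<inter> \<Union>\<D> = {}" using insert.prems(1) insert.hyps(2) by (auto simp: disjoint_def)
  have cong: "(\<Prod>d\<in>\<D>. F d f) = (\<Prod>d\<in>\<D>. F d g)" if "\<And>x. x \<in> \<Union>\<D> \<Longrightarrow> f x = g x" for f g
    using that by (intro prod.cong refl insert.prems(2)) auto
  have "(\<Prod>d\<in>insert c \<D>. \<Sum>f\<in>d \<rightarrow>\<^sub>E B. F d f) =
      (\<Sum>f\<in>c \<rightarrow>\<^sub>E B. F c f) * (\<Sum>f\<in>\<Union>\<D> \<rightarrow>\<^sub>E B. \<Prod>d\<in>\<D>. F d f)"
  proof -
    have "(\<Prod>d\<in>\<D>. \<Sum>f\<in>d \<rightarrow>\<^sub>E B. F d f) = (\<Sum>f\<in>\<Union>\<D> \<rightarrow>\<^sub>E B. \<Prod>d\<in>\<D>. F d f)"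
      by (rule insert.IH) (use insert.prems(1) in \<open>simp add: disjoint_def\<close>, rule insert.prems(2), simp)
    then show ?thesis using insert.hyps by simp
  qed
  also have "\<dots> = (\<Sum>f\<in>c \<union> \<Union>\<D> \<rightarrow>\<^sub>E B. F c f * (\<Prod>d\<in>\<D>. F d f))"
    by (rule sum_PiE_Un_disjoint[OF disj]) (rule insert.prems(2), simp, simp, rule cong, simp)
  also have "\<dots> = (\<Sum>f\<in>\<Union>(insert c \<D>) \<rightarrow>\<^sub>E B. \<Prod>d\<in>insert c \<D>. F d f)"
    using insert.hyps by simp
  finally show ?case .
qed

text \<open>
  The cycles partition \<open>S\<close> and are closed under \<open>\<pi>\<close>, so choosing a labelling for each cycle
  is the same as choosing one for all of \<open>S\<close>.
\<close>
lemma prod_trace_matrix_pow_cycles: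
  fixes A :: "complex ^ 'n ^ 'n"
  assumes \<pi>: "\<pi> permutes S" and S: "finite S"
  shows "(\<Prod>c\<in>perm_cycles S \<pi>. trace (matrix_pow A (card c))) =
    (\<Sum>i\<in>S \<rightarrow>\<^sub>E UNIV. \<Prod>m\<in>S. A $ i m $ i (\<pi> m))"
proof -
  have closed: "\<pi> x \<in> c" if "c \<in> perm_cycles S \<pi>" "x \<in> c" for c x
    using that by (auto simp: perm_cycles_def intro: orbit.step)
  have fin: "\<forall>c\<in>perm_cycles S \<pi>. finite c"
    using S permutes_orbit_subset[OF \<pi>] by (auto simp: perm_cycles_def intro: finite_subset)
  have "(\<Prod>c\<in>perm_cycles S \<pi>. trace (matrix_pow A (card c))) =
      (\<Prod>c\<in>perm_cycles S \<pi>. \<Sum>i\<in>c \<rightarrow>\<^sub>E UNIV. \<Prod>m\<in>c. A $ i m $ i (\<pi> m))"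
    using trace_matrix_pow_cycle[OF self_in_orbit_permutes[OF assms]]
    by (intro prod.cong refl) (auto simp: perm_cycles_def)
  also have "\<dots> = (\<Sum>i\<in>\<Union>(perm_cycles S \<pi>) \<rightarrow>\<^sub>E UNIV.
      \<Prod>c\<in>perm_cycles S \<pi>. \<Prod>m\<in>c. A $ i m $ i (\<pi> m))"
    using S closed by (intro prod_sum_PiE_disjoint_family disjoint_perm_cycles[OF assms] prod.cong)
      (auto simp: perm_cycles_def)
  also have "\<dots> = (\<Sum>i\<in>S \<rightarrow>\<^sub>E UNIV. \<Prod>m\<in>S. A $ i m $ i (\<pi> m))"
    using prod.Union_disjoint[OF fin, of "\<lambda>m. A $ _ m $ _ (\<pi> m)"] disjoint_perm_cycles[OF assms]
    by (simp add: Union_perm_cycles[OF assms] disjoint_def)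
  finally show ?thesis .
qed

section \<open>Commutators and the expectation of products of traces\<close>

lemma perm_commutator_permutes:
  assumes "\<sigma> permutes S" "\<tau> permutes S"
  shows "perm_commutator \<sigma> \<tau> permutes S"
  unfolding perm_commutator_def using assms by (intro permutes_compose permutes_inv)

text \<open>
  Substitute \<open>x = \<tau> (\<sigma> m)\<close>: the commutator maps it to \<open>\<sigma> (\<tau> m)\<close>.
\<close>
lemma intertwined_iff_invariant_commutator:
  assumes \<sigma>: "\<sigma> permutes S" and \<tau>: "\<tau> permutes S"
  shows "(\<forall>m\<in>S. i (\<tau> (\<sigma> m)) = i (\<sigma> (\<tau> m))) \<longleftrightarrow> (\<forall>x\<in>S. i (perm_commutator \<sigma> \<tau> x) = i x)"
proof -
  have "(\<forall>x\<in>S. i (perm_commutator \<sigma> \<tau> x) = i x) \<longleftrightarrow>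
      (\<forall>x\<in>(\<tau> \<circ> \<sigma>) ` S. i (perm_commutator \<sigma> \<tau> x) = i x)"
    using permutes_image[OF permutes_compose[OF \<sigma> \<tau>]] by simp
  also have "\<dots> \<longleftrightarrow> (\<forall>m\<in>S. i (\<sigma> (\<tau> m)) = i (\<tau> (\<sigma> m)))"
    by (simp add: perm_commutator_def permutes_inverses[OF \<sigma>] permutes_inverses[OF \<tau>])
  finally show ?thesis by metis
qed

text \<open>
  Comparing first components, \<open>j\<close> is determined by \<open>i\<close> as \<open>i \<circ> \<sigma>\<close>; comparing second components then
  leaves exactly the condition that \<open>i\<close> is invariant under the commutator.
\<close>
lemma card_matched_label_pairs:
  fixes S :: "'m set"
  assumes \<sigma>: "\<sigma> permutes S" and \<tau>: "\<tau> permutes S" and S: "finite S"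
  shows "card {(i, j) \<in> (S \<rightarrow>\<^sub>E (UNIV :: 'n::finite set)) \<times> (S \<rightarrow>\<^sub>E UNIV).
      \<forall>m\<in>S. (i (\<sigma> m), i (\<tau> (\<sigma> m))) = (j m, j (\<tau> m))} =
    CARD('n) ^ num_cycles S (perm_commutator \<sigma> \<tau>)" (is "card ?P = _")
proof -
  let ?I = "{i \<in> S \<rightarrow>\<^sub>E (UNIV :: 'n set). \<forall>x\<in>S. i (perm_commutator \<sigma> \<tau> x) = i x}"
  have "bij_betw fst ?P ?I"
  proof (rule bij_betw_byWitness[where f' = "\<lambda>i. (i, \<lambda>m\<in>S. i (\<sigma> m))"])
    show "\<forall>p\<in>?P. (fst p, \<lambda>m\<in>S. fst p (\<sigma> m)) = p"
      by (auto simp: fun_eq_iff PiE_iff extensional_def)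
    show "fst ` ?P \<subseteq> ?I"
    proof safe
      fix i j x assume ij: "\<forall>m\<in>S. (i (\<sigma> m), i (\<tau> (\<sigma> m))) = (j m, j (\<tau> m))" and x: "x \<in> S"
      have "i (\<tau> (\<sigma> m)) = i (\<sigma> (\<tau> m))" if "m \<in> S" for m
        using ij that permutes_in_image[OF \<tau>, of m] by simp
      then have "i (perm_commutator \<sigma> \<tau> x) = i x"
        using intertwined_iff_invariant_commutator[OF \<sigma> \<tau>, of i] x by blast
      then show "fst (i, j) (perm_commutator \<sigma> \<tau> x) = fst (i, j) x" by simp
    qed auto
    show "(\<lambda>i. (i, \<lambda>m\<in>S. i (\<sigma> m))) ` ?I \<subseteq> ?P"
    proof safe
      fix i :: "'m \<Rightarrow> 'n" and m
      assume "\<forall>x\<in>S. i (perm_commutator \<sigma> \<tau> x) = i x" and m: "m \<in> S"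
      then have "i (\<tau> (\<sigma> m)) = i (\<sigma> (\<tau> m))"
        using intertwined_iff_invariant_commutator[OF \<sigma> \<tau>, of i] by blast
      then show "i (\<sigma> m) = (\<lambda>m\<in>S. i (\<sigma> m)) m" "i (\<tau> (\<sigma> m)) = (\<lambda>m\<in>S. i (\<sigma> m)) (\<tau> m)"
        using m permutes_in_image[OF \<tau>, of m] by simp_all
    qed auto
  qed auto
  then show ?thesis
    using card_invariant_labellings[OF perm_commutator_permutes[OF \<sigma> \<tau>] S, where ?'n = 'n]
    by (simp add: bij_betw_same_card)
qed

text \<open>
  Summing the Wick formula over pairs of labellings counts triples \<open>(i, j, \<sigma>)\<close>; grouping
  the triples by \<open>\<sigma>\<close> gives the right-hand side.
\<close>
theorem (in prob_space) expectation_prod_trace_cycles: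
  fixes G :: "'a \<Rightarrow> complex ^ 'n ^ 'n"
  assumes G: "complex_gaussian_matrix G" and \<tau>: "\<tau> permutes S" and S: "finite S"
  shows "expectation (\<lambda>\<omega>. \<Prod>c\<in>perm_cycles S \<tau>. (cmod (trace (matrix_pow (G \<omega>) (card c))))\<^sup>2) =
    (\<Sum>\<sigma> | \<sigma> permutes S. real CARD('n) ^ num_cycles S (perm_commutator \<sigma> \<tau>))"
proof -
  define Z where "Z = (\<lambda>(i, j) \<omega>. G \<omega> $ i $ j)"
  define L where "L = S \<rightarrow>\<^sub>E (UNIV :: 'n set)"
  have Z: "std_complex_gaussian (Z e)" for e
    using G by (cases e) (simp add: Z_def complex_gaussian_matrix_def)
  have ind: "indep_vars (\<lambda>_. borel) Z UNIV"
    using G by (simp add: Z_def complex_gaussian_matrix_def)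
  have finL: "finite L" using S by (simp add: L_def finite_PiE)
  have finP: "finite {\<sigma>. \<sigma> permutes S}" using S by (rule finite_permutations)
  let ?X = "\<lambda>\<omega>. \<Prod>c\<in>perm_cycles S \<tau>. (cmod (trace (matrix_pow (G \<omega>) (card c))))\<^sup>2"
  let ?e = "\<lambda>i m. (i m, i (\<tau> m))"
  let ?m = "\<lambda>i j \<omega>. (\<Prod>m\<in>S. Z (?e i m) \<omega>) * (\<Prod>m\<in>S. cnj (Z (?e j m) \<omega>))"
  have expand: "complex_of_real (?X \<omega>) = (\<Sum>i\<in>L. \<Sum>j\<in>L. ?m i j \<omega>)" for \<omega>
  proof -
    let ?t = "\<Prod>c\<in>perm_cycles S \<tau>. trace (matrix_pow (G \<omega>) (card c))"
    have t: "?t = (\<Sum>i\<in>L. \<Prod>m\<in>S. Z (?e i m) \<omega>)"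
      unfolding prod_trace_matrix_pow_cycles[OF \<tau> S] by (simp add: L_def Z_def)
    have "complex_of_real (?X \<omega>) = ?t * cnj ?t"
      by (simp add: complex_norm_square prod.distrib del: of_real_power)
    also have "\<dots> = (\<Sum>i\<in>L. \<Sum>j\<in>L. ?m i j \<omega>)"
      unfolding t by (simp add: sum_product)
    finally show ?thesis .
  qed
  have wick: "expectation (?m i j) = (\<Sum>\<sigma> | \<sigma> permutes S. of_bool (\<forall>m\<in>S. ?e i (\<sigma> m) = ?e j m))" for i j
  proof -
    have "expectation (?m i j) = of_nat (card {\<sigma>. \<sigma> permutes S \<and> (\<forall>m\<in>S. ?e i (\<sigma> m) = ?e j m)})"
      using gaussian_wick_formula[OF Z ind S S refl, of "?e i" "?e j"]
        card_matchings_permutes[OF S, of "?e i" "?e j"] by simp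
    also have "{\<sigma>. \<sigma> permutes S \<and> (\<forall>m\<in>S. ?e i (\<sigma> m) = ?e j m)} =
        {\<sigma>. \<sigma> permutes S} \<inter> {\<sigma>. \<forall>m\<in>S. ?e i (\<sigma> m) = ?e j m}" by auto
    also have "of_nat (card \<dots>) = (\<Sum>\<sigma> | \<sigma> permutes S. of_bool (\<forall>m\<in>S. ?e i (\<sigma> m) = ?e j m))"
      using finP by (simp add: sum_of_bool_eq)
    finally show ?thesis .
  qed
  have "complex_of_real (expectation ?X) = expectation (\<lambda>\<omega>. \<Sum>i\<in>L. \<Sum>j\<in>L. ?m i j \<omega>)"
    unfolding integral_complex_of_real[symmetric] expand ..
  also have "\<dots> = (\<Sum>i\<in>L. \<Sum>j\<in>L. expectation (?m i j))"
    by (simp add: Bochner_Integration.integral_sum Bochner_Integration.integrable_sum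
        gaussian_monomial_integrable[OF Z ind S S])
  also have "\<dots> = (\<Sum>i\<in>L. \<Sum>j\<in>L. \<Sum>\<sigma> | \<sigma> permutes S. of_bool (\<forall>m\<in>S. ?e i (\<sigma> m) = ?e j m))"
    unfolding wick ..
  also have "\<dots> = (\<Sum>(i, j)\<in>L \<times> L. \<Sum>\<sigma> | \<sigma> permutes S. of_bool (\<forall>m\<in>S. ?e i (\<sigma> m) = ?e j m))"
    by (rule sum.cartesian_product)
  also have "\<dots> = (\<Sum>\<sigma> | \<sigma> permutes S. \<Sum>(i, j)\<in>L \<times> L. of_bool (\<forall>m\<in>S. ?e i (\<sigma> m) = ?e j m))"
    unfolding case_prod_unfold by (rule sum.swap)
  also have "\<dots> = (\<Sum>\<sigma> | \<sigma> permutes S. of_nat (CARD('n) ^ num_cycles S (perm_commutator \<sigma> \<tau>)))"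
  proof (intro sum.cong refl)
    fix \<sigma> assume "\<sigma> \<in> {\<sigma>. \<sigma> permutes S}"
    then have \<sigma>: "\<sigma> permutes S" by simp
    have "(\<Sum>(i, j)\<in>L \<times> L. of_bool (\<forall>m\<in>S. ?e i (\<sigma> m) = ?e j m)) =
        of_nat (card ((L \<times> L) \<inter> {p. \<forall>m\<in>S. ?e (fst p) (\<sigma> m) = ?e (snd p) m}))"
      unfolding case_prod_unfold using finL by (intro sum_of_bool_eq finite_cartesian_product)
    also have "(L \<times> L) \<inter> {p. \<forall>m\<in>S. ?e (fst p) (\<sigma> m) = ?e (snd p) m} =
        {(i, j) \<in> L \<times> L. \<forall>m\<in>S. ?e i (\<sigma> m) = ?e j m}" by auto
    finally show "(\<Sum>(i, j)\<in>L \<times> L. of_bool (\<forall>m\<in>S. ?e i (\<sigma> m) = ?e j m)) =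
        of_nat (CARD('n) ^ num_cycles S (perm_commutator \<sigma> \<tau>))"
      unfolding L_def card_matched_label_pairs[OF \<sigma> \<tau> S] .
  qed
  also have "\<dots> = complex_of_real (\<Sum>\<sigma> | \<sigma> permutes S. real CARD('n) ^ num_cycles S (perm_commutator \<sigma> \<tau>))"
    by simp
  finally show ?thesis unfolding of_real_eq_iff .
qed

theorem lemma9:
  fixes P :: "'a measure"
    and G :: "'a \<Rightarrow> complex ^ 'n ^ 'n"
    and K M :: nat
    and C :: "nat \<Rightarrow> nat"
    and \<tau> :: "nat \<Rightarrow> nat"
  assumes "prob_space P"
    and "prob_space.complex_gaussian_matrix P G"
    and "K \<ge> 1"
    and "\<And>k. k \<in> {1..K} \<Longrightarrow> C k \<ge> 1"
    and "(\<Sum>k=1..K. C k) = M"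
    and "\<tau> permutes {1..M}"
    and "has_cycle_sizes {1..M} \<tau> K C"
  shows "prob_space.expectation P (\<lambda>\<omega>. \<Prod>k=1..K. (cmod (trace (matrix_pow (G \<omega>) (C k))))\<^sup>2) =
         fact M * measure_pmf.expectation (pmf_of_set {\<sigma>. \<sigma> permutes {1..M}})
           (\<lambda>\<sigma>. real CARD('n) ^ num_cycles {1..M} (perm_commutator \<sigma> \<tau>))"
proof -
  let ?S = "{1..M}" and ?perms = "{\<sigma>. \<sigma> permutes {1..M}}"
  obtain c where c: "bij_betw c {1..K} (perm_cycles ?S \<tau>)" "\<forall>k\<in>{1..K}. card (c k) = C k"
    using assms(7) by (auto simp: has_cycle_sizes_def)
  have "(\<Prod>k=1..K. (cmod (trace (matrix_pow A (C k))))\<^sup>2) =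
      (\<Prod>c\<in>perm_cycles ?S \<tau>. (cmod (trace (matrix_pow A (card c))))\<^sup>2)" for A :: "complex ^ 'n ^ 'n"
    by (subst prod.reindex_bij_betw[OF c(1), symmetric]) (use c(2) in auto)
  then have "prob_space.expectation P (\<lambda>\<omega>. \<Prod>k=1..K. (cmod (trace (matrix_pow (G \<omega>) (C k))))\<^sup>2) =
      (\<Sum>\<sigma>\<in>?perms. real CARD('n) ^ num_cycles ?S (perm_commutator \<sigma> \<tau>))"
    using prob_space.expectation_prod_trace_cycles[OF assms(1,2,6)] by simp
  moreover have "?perms \<noteq> {}" using permutes_id[of ?S] by blast
  moreover have "finite ?perms" "card ?perms = fact M"
    using finite_permutations[of ?S] card_permutations[of ?S M] by auto
  ultimately show ?thesis
    by (simp add: integral_pmf_of_set)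
qed

end
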